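(* Let $A$ be an associative algebra over a field $\mathbb{K}$, let $(A,R,S,\sigma)$ be a homothetic Rota-Baxter system and let $m$ be any natural number. Define $m+1$ linear operations $\ast_i: A\otimes A \to A$, $i=0,\ldots, m$, as follows: $$ a\ast_i b = \begin{cases} R(a) b, & i=0,\\ (-1)^{i+1}\,a\sigma b, & i = 1,\ldots, m-1,\\ a S(b) -\frac{1 + (-1)^m}{2}\, a\sigma b, & i=m, \end{cases} $$ for all $a,b\in A$, where $a\sigma b := a(\sigma b) = (a\sigma)b$. Then $\left(A, \{\ast_i\}_{i=0}^m\right)$ is a Dyck$^m$-algebra.
   Context: Let $A$ be an associative algebra over a field $\mathbb{K}$ (not assumed to be unital). Rota-Baxter system: a triple $(A,R,S)$, where $R,S:A\to A$ are $\mathbb{K}$-linear operators such that, for all $a,b\in A$, $$R(a)R(b) = R\left(R(a) b + a S(b)\right), \qquad S(a)S(b) = S\left(R(a) b + a S(b)\right).$$ Double operator: a pair $\sigma = (\overrightarrow{\sigma},\overleftarrow{\sigma})$ of $\mathbb{K}$-linear operators on $A$, written $\overrightarrow{\sigma}: a\mapsto \sigma a$ and $\overleftarrow{\sigma}: a\mapsto a\sigma$. Double homothetism: a double operator $\sigma$ on $A$ such that, for all $a,b\in A$, $$\sigma(ab) = (\sigma a)b, \qquad (ab)\sigma = a(b\sigma), \qquad a(\sigma b) = (a\sigma)b, \qquad (\sigma a)\sigma = \sigma(a\sigma).$$ Because of these identities brackets are omitted in strings of letters involving elements of $A$ and $\sigma$; e.g. $a\sigma b = a(\sigma b) = (a\sigma)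 b$ and $\sigma a\sigma = (\sigma a)\sigma=\sigma(a\sigma)$. Homothetic Rota-Baxter system: a quadruple $(A,R,S,\sigma)$ such that $(A,R,S)$ is a Rota-Baxter system, $\sigma$ is a double homothetism on $A$, and, for all $a\in A$, $$S(a)\sigma - \sigma R(a) = \sigma a \sigma.$$ Dyck$^m$-algebra, for a natural number $m$ (the case $m=0$ being that of associative algebras, the case $m=1$ that of dendriform algebras): a $\mathbb{K}$-vector space $A$ together with $m+1$ linear operations $\ast_i: A\otimes A\to A$, $i=0,\ldots , m$, such that, for all $a,b,c\in A$, $$a\ast_i (b\ast_j c) = (a\ast_i b)\ast_j c, \qquad 0\leq i<j\leq m,$$ $$a\ast_0(b\ast_0 c) = \left(\sum_{i=0}^m a\ast_i b\right)\ast_0 c,$$ $$a\ast_m \left(\sum_{i=0}^m b\ast_i c\right) = (a\ast_m b)\ast_m c,$$ $$a\ast_i \left(\sum_{k=0}^i b\ast_k c\right) = \left(\sum_{k=i}^m a\ast_k b\right)\ast_i c, \qquad 1\leq i\leq m-1.$$ *)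

theory Defs
  imports Complex_Main
begin

text \<open>
  Associative algebras are not assumed to be unital; the type class \<^class>\<open>ring\<close> does not
  provide a unit.
\<close>

locale assoc_algebra = vector_space scale
  for scale :: "'k::field \<Rightarrow> 'a::ring \<Rightarrow> 'a" +
  assumes scale_mult_left: "scale c a * b = scale c (a * b)"
    and scale_mult_right: "a * scale c b = scale c (a * b)"

locale rota_baxter_system = assoc_algebra scale
  for scale :: "'k::field \<Rightarrow> 'a::ring \<Rightarrow> 'a" +
  fixes R S :: "'a \<Rightarrow> 'a"
  assumes linear_R: "Vector_Spaces.linear scale scale R"
    and linear_S: "Vector_Spaces.linear scale scale S"
    and R_mult: "R a * R b = R (R a * b + a * S b)"
    and S_mult: "S a * S b = S (R a * b + a * S b)"

text \<open>
  A double operator \<open>\<sigma>\<close> is given by its two components: \<open>\<sigma>l a\<close> stands for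
  \<open>\<sigma> a\<close> and \<open>\<sigma>r a\<close> for \<open>a \<sigma>\<close>.
\<close>

locale double_homothetism = assoc_algebra scale
  for scale :: "'k::field \<Rightarrow> 'a::ring \<Rightarrow> 'a" +
  fixes \<sigma>l \<sigma>r :: "'a \<Rightarrow> 'a"
  assumes linear_left: "Vector_Spaces.linear scale scale \<sigma>l"
    and linear_right: "Vector_Spaces.linear scale scale \<sigma>r"
    and left_mult: "\<sigma>l (a * b) = \<sigma>l a * b"
    and right_mult: "\<sigma>r (a * b) = a * \<sigma>r b"
    and balanced: "a * \<sigma>l b = \<sigma>r a * b"
    and commute: "\<sigma>r (\<sigma>l a) = \<sigma>l (\<sigma>r a)"

locale homothetic_rota_baxter_system =
  rota_baxter_system scale R S + double_homothetism scale \<sigma>l \<sigma>r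
  for scale :: "'k::field \<Rightarrow> 'a::ring \<Rightarrow> 'a"
    and R S \<sigma>l \<sigma>r :: "'a \<Rightarrow> 'a" +
  assumes homothetic: "\<sigma>r (S a) - \<sigma>l (R a) = \<sigma>r (\<sigma>l a)"

text \<open>
  The operations \<open>A \<otimes> A \<rightarrow> A\<close> of a Dyck algebra are rendered as bilinear maps.
  Only \<open>ast i\<close> with \<open>i \<le> m\<close> is constrained.
\<close>

locale dyck_algebra = vector_space scale
  for scale :: "'k::field \<Rightarrow> 'a::ab_group_add \<Rightarrow> 'a" +
  fixes m :: nat
    and ast :: "nat \<Rightarrow> 'a \<Rightarrow> 'a \<Rightarrow> 'a"
  assumes linear_ast_left: "i \<le> m \<Longrightarrow> Vector_Spaces.linear scale scale (\<lambda>a. ast i a b)"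
    and linear_ast_right: "i \<le> m \<Longrightarrow> Vector_Spaces.linear scale scale (\<lambda>b. ast i a b)"
    and ast_less: "i < j \<Longrightarrow> j \<le> m \<Longrightarrow> ast i a (ast j b c) = ast j (ast i a b) c"
    and ast_first: "ast 0 a (ast 0 b c) = ast 0 (\<Sum>i=0..m. ast i a b) c"
    and ast_last: "ast m a (\<Sum>i=0..m. ast i b c) = ast m (ast m a b) c"
    and ast_middle: "1 \<le> i \<Longrightarrow> i < m \<Longrightarrow>
      ast i a (\<Sum>k=0..i. ast k b c) = ast i (\<Sum>k=i..m. ast k a b) c"

end

theory Submission imports Defs begin

text \<open>
  For \<open>i < m\<close> the alternating signs give
  \<open>\<Sum>\<^sub>k\<^sub>\<le>\<^sub>i a \<ast>\<^sub>k b = R(a)b\<close> or \<open>R(a)b + a\<sigma>b\<close>, according to whether \<open>i\<close> is even or odd, and the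
  correction term in \<open>\<ast>\<^sub>m\<close> makes the full sum equal to \<open>R(a)b + aS(b)\<close> whenever \<open>m \<ge> 1\<close>. The
  identities then reduce to the Rota-Baxter relations and to
  \<open>aS(b)\<sigma>c = a\<sigma>R(b)c + a\<sigma>b\<sigma>c\<close>. For \<open>m = 0\<close> the hypotheses force
  \<open>R(a)b = aS(b) - a\<sigma>b\<close>, and so
  \<open>R(R(a)b)c = R(a)bS(c) - R(a)b\<sigma>c = R(a)R(b)c\<close>.
\<close>

context homothetic_rota_baxter_system
begin

text \<open>Balancing moves \<open>\<sigma>\<close> from \<open>c\<close> onto \<open>S b\<close>,
  where \<open>homothetic\<close> applies. The left factor and the bracketing match the normal form
  of \<open>algebra_simps\<close>.\<close>

lemma homothetic_sandwich:
  "a * (S b * \<sigma>l c) = a * (\<sigma>l (R b) * c) + a * (\<sigma>l b * \<sigma>l c)"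
proof -
  have "S b * \<sigma>l c = \<sigma>r (S b) * c"
    by (rule balanced)
  also have "\<dots> = \<sigma>l (R b) * c + \<sigma>r (\<sigma>l b) * c"
    by (simp add: homothetic [symmetric] algebra_simps)
  also have "\<sigma>r (\<sigma>l b) * c = \<sigma>l b * \<sigma>l c"
    by (rule balanced [symmetric])
  finally show ?thesis
    by (simp add: distrib_left)
qed

end

theorem theorem1:
  fixes scale :: "'k::field \<Rightarrow> 'a::ring \<Rightarrow> 'a"
    and R S \<sigma>l \<sigma>r :: "'a \<Rightarrow> 'a"
    and m :: nat
    and ast :: "nat \<Rightarrow> 'a \<Rightarrow> 'a \<Rightarrow> 'a"
  assumes "homothetic_rota_baxter_system scale R S \<sigma>l \<sigma>r"
    and "\<And>a b. ast 0 a b = R a * b"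
    and "\<And>i a b. 1 \<le> i \<Longrightarrow> i < m \<Longrightarrow> ast i a b = scale ((-1) ^ (i + 1)) (a * \<sigma>l b)"
    and "\<And>a b. ast m a b = a * S b - scale (of_int ((1 + (-1) ^ m) div 2)) (a * \<sigma>l b)"
  shows "dyck_algebra scale m ast"
proof -
  interpret homothetic_rota_baxter_system scale R S \<sigma>l \<sigma>r by fact
  interpret R: Vector_Spaces.linear scale scale R by (rule linear_R)
  interpret S: Vector_Spaces.linear scale scale S by (rule linear_S)
  interpret L: Vector_Spaces.linear scale scale \<sigma>l by (rule linear_left)
  note ast_0 = assms(2)
  have ast_mid: "ast i a b = (if odd i then a * \<sigma>l b else - (a * \<sigma>l b))"
    if "1 \<le> i" "i < m" for i a b
    using assms(3) [OF that] by auto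
  have ast_m: "ast m a b = a * S b - (if even m then a * \<sigma>l b else 0)" for a b
    using assms(4) by auto
  have ast_cases: "i = 0 \<or> 1 \<le> i \<and> i < m \<or> i = m" if "i \<le> m" for i
    using that by linarith
  note linear_simps = R.add R.scale S.add S.scale L.add L.scale
    scale_mult_left scale_mult_right scale_right_diff_distrib distrib_left distrib_right
  have partial: "(\<Sum>k=0..i. ast k a b) = R a * b + (if odd i then a * \<sigma>l b else 0)"
    if "i < m" for i a b
    using that
  proof (induction i)
    case (Suc i)
    then show ?case using ast_mid [of "Suc i" a b] by simp
  qed (simp add: ast_0)
  have total: "(\<Sum>k=0..m. ast k a b) = R a * b + a * S b" if nz: "m \<noteq> 0" for a b
  proof -
    obtain n where n: "m = Suc n" using nz by (cases m) auto
    have "(\<Sum>k=0..m. ast k a b) = (\<Sum>k=0..n. ast k a b) + ast m a b"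
      by (simp add: n)
    \<comment> \<open>The partial sum leaves a \<open>\<sigma>\<close>-term for odd
      \<open>n\<close>, that is for even \<open>m\<close>, exactly when \<open>ast m\<close>
      subtracts it.\<close>
    also have "\<dots> = R a * b + a * S b"
      using partial [of n a b] by (simp add: ast_m) (simp add: n)
    finally show ?thesis .
  qed
  \<comment> \<open>For positive index the first argument enters only as a left factor; at index 0
    the operator \<open>R\<close> intervenes.\<close>
  have left_module: "x * ast j b c = ast j (x * b) c" if "0 < j" "j \<le> m" for j x b c
    using that ast_cases [OF that(2)] by (auto simp: ast_mid ast_m algebra_simps)
  have assoc_0: "ast 0 a (ast 0 b c) = ast 0 (ast 0 a b) c" if "m = 0" for a b c
  proof -
    have *: "R x * y = x * S y - x * \<sigma>l y" for x y
      using ast_0 [of x y] ast_m [of x y] that by simp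
    have "R (R a * b) * c = R a * (b * S c - b * \<sigma>l c)"
      by (subst *) (simp add: algebra_simps)
    also have "\<dots> = R a * (R b * c)"
      by (simp only: *)
    finally show ?thesis
      by (simp add: ast_0)
  qed
  show ?thesis
  proof (intro dyck_algebra.intro dyck_algebra_axioms.intro)
    show "vector_space scale" by (rule vector_space_axioms)
  next
    fix i b assume i: "i \<le> m"
    show "Vector_Spaces.linear scale scale (\<lambda>a. ast i a b)"
      by (unfold_locales; use ast_cases [OF i] in
        \<open>auto simp: ast_0 ast_mid ast_m linear_simps\<close>)
  next
    fix i a assume i: "i \<le> m"
    show "Vector_Spaces.linear scale scale (\<lambda>b. ast i a b)"
      by (unfold_locales; use ast_cases [OF i] in
        \<open>auto simp: ast_0 ast_mid ast_m linear_simps\<close>)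
  next
    fix i j a b c assume ij: "i < j" "j \<le> m"
    show "ast i a (ast j b c) = ast j (ast i a b) c"
    proof (cases "i = 0")
      case True
      then show ?thesis using ij by (simp add: ast_0 left_module)
    next
      case False
      \<comment> \<open>Balancing turns \<open>ast i a\<close> into left multiplication by a fixed
        element, so \<open>left_module\<close> suffices.\<close>
      define s where "s = (if odd i then \<sigma>r a else - \<sigma>r a)"
      have "ast i a y = s * y" for y
        using False ij ast_mid [of i a y] by (simp add: s_def balanced)
      then show ?thesis using ij by (simp add: left_module)
    qed
  next
    fix a b c
    show "ast 0 a (ast 0 b c) = ast 0 (\<Sum>i=0..m. ast i a b) c"
    proof (cases "m = 0")
      case False
      have "R a * (R b * c) = R (R a * b + a * S b) * c"
        by (simp add: R_mult [symmetric] mult.assoc)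
      then show ?thesis by (simp add: total [OF False] ast_0)
    qed (simp add: assoc_0)
  next
    fix a b c
    show "ast m a (\<Sum>i=0..m. ast i b c) = ast m (ast m a b) c"
    proof (cases "m = 0")
      case False
      \<comment> \<open>This settles odd \<open>m\<close>; for even \<open>m\<close> the extra
        \<open>\<sigma>\<close>-terms cancel by \<open>homothetic_sandwich\<close>.\<close>
      have "a * S (R b * c + b * S c) = a * (S b * S c)"
        by (simp add: S_mult)
      then show ?thesis
        by (simp add: total [OF False] ast_m L.add left_mult homothetic_sandwich algebra_simps)
    qed (simp add: assoc_0)
  next
    fix i a b c assume i: "1 \<le> i" "i < m"
    then obtain n where n: "i = Suc n" by (cases i) auto
    \<comment> \<open>The upper sum is the total minus the part below \<open>i\<close>; as
      \<open>n\<close> is \<open>i - 1\<close>, the parity flips.\<close>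
    have "(\<Sum>k=0..m. ast k a b) = (\<Sum>k=0..n. ast k a b) + (\<Sum>k=i..m. ast k a b)"
      using i sum.ub_add_nat [of 0 n "\<lambda>k. ast k a b" "m - n"] by (simp add: n)
    then have upper: "(\<Sum>k=i..m. ast k a b) = a * S b - (if even i then a * \<sigma>l b else 0)"
      using i total [of a b] partial [of n a b] by (simp add: n algebra_simps split: if_splits)
    show "ast i a (\<Sum>k=0..i. ast k b c) = ast i (\<Sum>k=i..m. ast k a b) c"
      \<comment> \<open>Both parities give \<open>homothetic_sandwich\<close>; for even
        \<open>i\<close> the term \<open>a * (\<sigma>l b * \<sigma>l c)\<close> changes
        sides.\<close>
      unfolding upper partial [OF i(2)] ast_mid [OF i]
      by (simp add: L.add left_mult homothetic_sandwich algebra_simps)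
  qed
qed

end
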